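(* Let $X$ be a finite set with at least three elements and let $\mathcal{P}$ be an $(m,k)$-partition of $X$ having exactly $m_i$ blocks of size $n_i$ for each $i\in I_k$, where $n_1<n_2<\cdots<n_k$ and $m=m_1+\cdots+m_k$. Then \[|E(\Gamma(X,\mathcal{P}))|=\sum_{r=1}^m\sum_{t=1}^{\mu_r}\prod_{i=1}^k\Big(\sum_{j=1}^i r_{t_j}\,(n_j!)\,S(n_i,n_j)\Big)^{m_i-r_{t_i}},\] where, for each $r\in I_m$, $\mathfrak{F}_r=\{\mathcal{Q}_{r1},\dots,\mathcal{Q}_{r\mu_r}\}$ is the collection of all $r$-subpartitions of $\mathcal{P}$ containing at least one block of size $n_1$, $\mu_r=|\mathfrak{F}_r|$, and $r_{t_i}\ge 0$ is the number of blocks of size $n_i$ in $\mathcal{Q}_{rt}\in\mathfrak{F}_r$ for each $i\in I_k$.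
   Context: $I_k=\{1,\dots,k\}$ and $I_m=\{1,\dots,m\}$. A partition of $X$ is a collection of nonempty pairwise disjoint subsets (blocks) with union $X$. For positive integers $m\ge k$, an $(m,k)$-partition is a partition with exactly $m$ blocks whose blocks have exactly $k$ distinct sizes. An $r$-subpartition of $\mathcal{P}$ is a subcollection of $\mathcal{P}$ consisting of $r$ blocks. $\Gamma(X,\mathcal{P})$ is the semigroup (under composition) of all maps $f\colon X\to X$ such that for every block $X_i\in\mathcal{P}$ there is a block $X_j\in\mathcal{P}$ with $X_if=X_j$, where $X_if$ denotes the image of $X_i$ under $f$. $E(\Gamma(X,\mathcal{P}))$ is the set of its idempotents ($f^2=f$). $S(a,b)$ denotes the Stirling number of the second kind, the number of partitions of an $a$-element set into $b$ blocks. *)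

theory Defs
  imports "HOL-Combinatorics.Stirling" "HOL-Library.Disjoint_Sets" "HOL-Library.FuncSet"
begin

definition mk_partition_on :: "nat \<Rightarrow> nat \<Rightarrow> 'a set \<Rightarrow> 'a set set \<Rightarrow> bool" where
  "mk_partition_on m k X P \<longleftrightarrow>
     0 < k \<and> k \<le> m \<and> partition_on X P \<and> card P = m \<and> card (card ` P) = k"

definition blocks_of_size :: "'a set set \<Rightarrow> nat \<Rightarrow> 'a set set" where
  "blocks_of_size P s = {B \<in> P. card B = s}"

definition subpartitions :: "nat \<Rightarrow> 'a set set \<Rightarrow> 'a set set set" where
  "subpartitions r P = {Q. Q \<subseteq> P \<and> card Q = r}"

text \<open>Self-maps of \<open>X\<close> are taken from \<open>X \<rightarrow>\<^sub>E X\<close>, i.e. they are \<open>undefined\<close> outside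
  \<open>X\<close>, so that each map is counted once; accordingly they are composed by \<^const>\<open>compose\<close>.\<close>

definition Gamma :: "'a set \<Rightarrow> 'a set set \<Rightarrow> ('a \<Rightarrow> 'a) set" where
  "Gamma X P = {f \<in> X \<rightarrow>\<^sub>E X. \<forall>A\<in>P. \<exists>B\<in>P. f ` A = B}"

definition idempotents :: "'a set \<Rightarrow> ('a \<Rightarrow> 'a) set \<Rightarrow> ('a \<Rightarrow> 'a) set" where
  "idempotents X S = {f \<in> S. compose X f f = f}"

lemma Gamma_compose_closed:
  assumes "partition_on X P" "f \<in> Gamma X P" "g \<in> Gamma X P"
  shows "compose X g f \<in> Gamma X P"
proof -
  have "compose X g f ` A = g ` f ` A" if "A \<in> P" for A
  proof -
    have "A \<subseteq> X" using that assms(1) partition_onD1 by blast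
    then show ?thesis by (force simp: compose_def)
  qed
  then show ?thesis
    using assms(2,3) by (fastforce simp: Gamma_def compose_def PiE_iff)
qed

text \<open>The library defines \<^const>\<open>Stirling\<close> by its recurrence; it does count partitions.\<close>

lemma card_partition_on_eq_Stirling:
  assumes "finite A"
  shows "card {P. partition_on A P \<and> card P = k} = Stirling (card A) k"
  using assms
proof (induction A arbitrary: k rule: finite_induct)
  case empty
  show ?case by (cases k) (auto simp: partition_on_empty cong: conj_cong)
next
  case (insert a A)
  define F where "F = (\<lambda>(B::'a set) k. {P. partition_on B P \<and> card P = k})"
  have finF: "finite (F B k)" if "finite B" for B k
    unfolding F_def using finitely_many_partition_on[OF that] by simp
  have finP: "finite P" if "P \<in> F B k" "finite B" for P B k
    using that finite_elements unfolding F_def by blast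
  show ?case
  proof (cases k)
    case 0
    have "F (insert a A) 0 = {}"
    proof (rule ccontr)
      assume "F (insert a A) 0 \<noteq> {}"
      then obtain P where P: "P \<in> F (insert a A) 0" by blast
      then have "finite P" using finP insert.hyps by blast
      with P have "P = {}" "partition_on (insert a A) P" by (auto simp: F_def)
      then show False using partition_onD1 by blast
    qed
    then have "card (F (insert a A) k) = 0" using 0 by simp
    then show ?thesis using 0 insert.hyps unfolding F_def by simp
  next
    case (Suc l)
    define S where "S = F A (Suc l)"
    define up where "up = (\<lambda>(P, B::'a set). insert (insert a B) (P - {B}))"
    define U where "U = {Q \<in> F (insert a A) (Suc l). {a} \<in> Q}"
    define V where "V = {Q \<in> F (insert a A) (Suc l). {a} \<notin> Q}"
    have notin: "B \<subseteq> A \<and> a \<notin> B \<and> B \<noteq> {}" if "partition_on A P" "B \<in> P" for P B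
      using that insert.hyps partition_onD1[OF that(1)] partition_onD3[OF that(1)] by blast
    have "bij_betw (insert {a}) (F A l) U"
    proof (rule bij_betw_byWitness[where f' = "\<lambda>Q. Q - {{a}}"])
      show "\<forall>P\<in>F A l. insert {a} P - {{a}} = P"
        using notin by (fastforce simp: F_def)
      show "\<forall>Q\<in>U. insert {a} (Q - {{a}}) = Q" by (auto simp: U_def)
      show "insert {a} ` F A l \<subseteq> U"
      proof safe
        fix P assume P: "P \<in> F A l"
        have "{a} \<notin> P" using P notin by (fastforce simp: F_def)
        moreover have "partition_on (insert a A) (insert {a} P)"
          using P insert.hyps notin[of P]
          by (auto simp: F_def partition_on_def disjoint_def)
        ultimately show "insert {a} P \<in> U"
          using P finP[OF P insert.hyps(1)] by (simp add: U_def F_def)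
      qed
      show "(\<lambda>Q. Q - {{a}}) ` U \<subseteq> F A l"
      proof safe
        fix Q assume Q: "Q \<in> U"
        then have p: "partition_on (insert a A) Q" and i: "{a} \<in> Q" and c: "card Q = Suc l"
          by (auto simp: U_def F_def)
        have "finite Q" using p insert.hyps finite_elements by blast
        have n: "a \<notin> B" if "B \<in> Q - {{a}}" for B
          using disjointD[OF partition_onD2[OF p], of B "{a}"] that i by blast
        have "\<Union>Q = insert a A" using partition_onD1[OF p] by simp
        moreover have "\<Union>Q = insert a (\<Union>(Q - {{a}}))" using i by blast
        moreover have "a \<notin> \<Union>(Q - {{a}})" using n by blast
        ultimately have "\<Union>(Q - {{a}}) = A" using insert.hyps(2) by (metis insert_ident)
        moreover have "disjoint (Q - {{a}})"
          using partition_onD2[OF p] by (rule pairwise_subset) blast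
        ultimately have "partition_on A (Q - {{a}})"
          using partition_onD3[OF p] by (simp add: partition_on_def)
        then show "Q - {{a}} \<in> F A l"
          using c i \<open>finite Q\<close> by (simp add: F_def)
      qed
    qed
    then have cU: "card U = Stirling (card A) l"
      using insert.IH[of l] bij_betw_same_card by (fastforce simp: F_def)
    have upV: "up (P, B) \<in> V" if "P \<in> S" "B \<in> P" for P B
    proof -
      have p: "partition_on A P" and c: "card P = Suc l" using that by (auto simp: S_def F_def)
      have fP: "finite P" using p insert.hyps finite_elements by blast
      have new: "insert a B \<notin> P" using notin[OF p] by blast
      have "\<Union>(insert (insert a B) (P - {B})) = insert a A"
        using partition_onD1[OF p] that(2) by blast
      moreover have "disjoint (insert (insert a B) (P - {B}))"
      proof -
        have "insert a B \<inter> D = {}" if "D \<in> P - {B}" for D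
          using disjointD[OF partition_onD2[OF p], of B D] notin[OF p, of D] that \<open>B \<in> P\<close> by blast
        moreover have "disjoint (P - {B})"
          using partition_onD2[OF p] by (rule pairwise_subset) blast
        ultimately show ?thesis by (auto simp: pairwise_insert disjnt_def)
      qed
      moreover have "{} \<notin> insert (insert a B) (P - {B})" using notin[OF p] by blast
      ultimately have "partition_on (insert a A) (up (P, B))"
        by (simp add: up_def partition_on_def)
      moreover have "card (up (P, B)) = Suc l"
        using new c fP that by (simp add: up_def)
      moreover have "{a} \<notin> up (P, B)" using notin[OF p] that by (auto simp: up_def)
      ultimately show ?thesis by (simp add: V_def F_def)
    qed
    have inj: "inj_on up (SIGMA P:S. P)"
    proof (rule inj_onI; clarify)
      fix P B P' B'
      assume P: "P \<in> S" "B \<in> P" and P': "P' \<in> S" "B' \<in> P'" and eq: "up (P, B) = up (P', B')"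
      have p: "partition_on A P" "partition_on A P'" using P P' by (auto simp: S_def F_def)
      note n = notin[OF p(1)] notin[OF p(2)]
      have "insert a B \<in> insert (insert a B') (P' - {B'})" using eq by (auto simp: up_def)
      then have "insert a B = insert a B'" using n(2) by blast
      then have B: "B = B'" using n(1)[OF P(2)] n(2)[OF P'(2)] by (metis insert_ident)
      have "P - {B} = up (P, B) - {insert a B}" using n(1) by (auto simp: up_def)
      moreover have "P' - {B} = up (P, B) - {insert a B}"
        unfolding eq using n(2) B by (auto simp: up_def)
      ultimately show "P = P' \<and> B = B'" using P P' B by blast
    qed
    have surj: "Q \<in> up ` (SIGMA P:S. P)" if Q: "Q \<in> V" for Q
    proof -
      have p: "partition_on (insert a A) Q" and c: "card Q = Suc l" and i: "{a} \<notin> Q"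
        using Q by (auto simp: V_def F_def)
      have fQ: "finite Q" using p insert.hyps finite_elements by blast
      obtain C where C: "C \<in> Q" "a \<in> C" using partition_onD1[OF p] by blast
      have n: "a \<notin> D" if "D \<in> Q" "D \<noteq> C" for D
        using disjointD[OF partition_onD2[OF p], of D C] that C by blast
      define B where "B = C - {a}"
      define P where "P = insert B (Q - {C})"
      have CB: "C = insert a B" using C(2) unfolding B_def by (simp add: insert_absorb)
      have ne: "B \<noteq> {}" using C(1) i CB by auto
      have "B \<notin> Q"
      proof
        assume "B \<in> Q"
        then have "B \<inter> C = {}"
          using disjointD[OF partition_onD2[OF p], of B C] C unfolding B_def by blast
        then show False using ne unfolding B_def by blast
      qed
      have "\<Union>Q = insert a A" using partition_onD1[OF p] by simp
      moreover have "\<Union>Q = insert a (\<Union>P)" using C CB by (auto simp: P_def)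
      moreover have "a \<notin> \<Union>P" using n by (auto simp: P_def B_def)
      ultimately have "\<Union>P = A" using insert.hyps(2) by (metis insert_ident)
      moreover have "disjoint P"
      proof -
        have "B \<inter> D = {}" if "D \<in> Q - {C}" for D
          using disjointD[OF partition_onD2[OF p], of C D] C that unfolding B_def by blast
        moreover have "disjoint (Q - {C})"
          using partition_onD2[OF p] by (rule pairwise_subset) blast
        ultimately show ?thesis by (auto simp: P_def pairwise_insert disjnt_def)
      qed
      moreover have "{} \<notin> P" using ne partition_onD3[OF p] by (simp add: P_def)
      ultimately have "partition_on A P" by (simp add: partition_on_def)
      moreover have "card P = Suc l"
        using c fQ C \<open>B \<notin> Q\<close> by (simp add: P_def card_Diff_singleton)
      ultimately have "P \<in> S" by (simp add: S_def F_def)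
      moreover have "up (P, B) = Q"
        using C CB \<open>B \<notin> Q\<close> by (auto simp: up_def P_def)
      moreover have "B \<in> P" by (simp add: P_def)
      ultimately show ?thesis by (intro image_eqI[of _ _ "(P, B)"]) simp_all
    qed
    have "up ` (SIGMA P:S. P) = V" using upV surj by blast
    then have "card V = card (SIGMA P:S. P)" using card_image[OF inj] by simp
    also have "\<dots> = (\<Sum>P\<in>S. card P)"
      using finF[OF insert.hyps(1)] finP[OF _ insert.hyps(1)] by (simp add: S_def)
    also have "\<dots> = Suc l * card S" by (simp add: S_def F_def)
    also have "\<dots> = Suc l * Stirling (card A) (Suc l)"
      using insert.IH[of "Suc l"] by (simp add: S_def F_def)
    finally have cV: "card V = Suc l * Stirling (card A) (Suc l)" .
    have "F (insert a A) (Suc l) = U \<union> V" by (auto simp: U_def V_def)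
    moreover have "card (U \<union> V) = card U + card V"
      using finF[of "insert a A" "Suc l"] insert.hyps
      by (intro card_Un_disjoint) (auto simp: U_def V_def)
    ultimately have "card (F (insert a A) (Suc l)) = card U + card V" by simp
    then show ?thesis using cU cV Suc insert.hyps by (simp add: F_def)
  qed
qed

end

theory Submission
  imports Defs
begin

text \<open>
  An idempotent \<open>f\<close> of \<^term>\<open>Gamma X P\<close> is determined by the set \<open>R\<close> of blocks that are images of
  blocks, together with what it does on each block separately.  Idempotency makes \<open>f\<close> the identity
  on every member of \<open>R\<close>, so that \<open>R\<close> is a subpartition of fixed blocks; every other block is mapped
  onto some member of \<open>R\<close> by an arbitrary surjection.  Conversely, any such choice of pieces glues
  to an idempotent with image blocks \<open>R\<close>.  So the idempotents belonging to \<open>R\<close> are counted by a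
  product over the blocks outside \<open>R\<close>, whose factor at \<open>A\<close> is the number of surjections from \<open>A\<close>
  onto members of \<open>R\<close>
  (lemma \<open>card_idempotents_onto_blocks\<close>, resting on \<open>card_piecewise_maps\<close> and \<open>card_surjections\<close>).

  A factor depends only on the size of \<open>A\<close> and on the sizes of the members of \<open>R\<close>, so collecting
  blocks of equal size turns the product over blocks into a product over sizes; the inner
  sum stops at \<open>j = i\<close> because a set has no surjection onto a larger one.  For the same reason a
  smallest block can only be mapped onto a smallest block, so only those \<open>R\<close> occur that
  contain a block of size \<open>n 1\<close>; the indices \<open>r\<close> and \<open>t\<close> list exactly these, by number of blocks.
\<close>

section \<open>Surjections between finite sets\<close>

definition surjections :: "'a set \<Rightarrow> 'b set \<Rightarrow> ('a \<Rightarrow> 'b) set" where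
  "surjections A B = {g \<in> A \<rightarrow>\<^sub>E B. g ` A = B}"

lemma finite_surjections: "finite A \<Longrightarrow> finite B \<Longrightarrow> finite (surjections A B)"
  unfolding surjections_def by (simp add: finite_PiE)

text \<open>Remove a point \<open>a\<close> from the domain.  If \<open>a\<close> is sent to \<open>b\<close>, the restriction to the rest must
  cover everything except possibly \<open>b\<close>.\<close>

lemma surjections_insert:
  assumes "a \<notin> A"
  shows "surjections (insert a A) B =
    (\<lambda>(b, g). g(a := b)) ` (SIGMA b:B. surjections A B \<union> surjections A (B - {b}))"
proof (intro subset_antisym subsetI)
  fix f assume "f \<in> surjections (insert a A) B"
  then have f: "f \<in> insert a A \<rightarrow>\<^sub>E B" and im: "f ` insert a A = B"
    by (auto simp: surjections_def)
  obtain b g where b: "b \<in> B" and g: "g \<in> A \<rightarrow>\<^sub>E B" and fg: "f = g(a := b)"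
    using f unfolding PiE_insert_eq by auto
  have "f ` A = g ` A" using assms fg by auto
  then have "insert b (g ` A) = B" using im fg by (simp only: image_insert fun_upd_same)
  then have "g ` A = B \<or> g ` A = B - {b}" by auto
  then have "g \<in> surjections A B \<union> surjections A (B - {b})"
    using g by (auto simp: surjections_def PiE_iff)
  then show "f \<in> (\<lambda>(b, g). g(a := b)) ` (SIGMA b:B. surjections A B \<union> surjections A (B - {b}))"
    using b fg by (intro image_eqI[of _ _ "(b, g)"]) auto
next
  fix f assume "f \<in> (\<lambda>(b, g). g(a := b)) ` (SIGMA b:B. surjections A B \<union> surjections A (B - {b}))"
  then obtain b g where b: "b \<in> B" and g: "g \<in> surjections A B \<union> surjections A (B - {b})"
    and fg: "f = g(a := b)" by auto
  have gE: "g \<in> A \<rightarrow>\<^sub>E B" and gim: "insert b (g ` A) = B"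
    using g b by (auto simp: surjections_def PiE_iff)
  have "f ` A = g ` A" using assms fg by auto
  then have "f ` insert a A = B" using gim fg by (simp only: image_insert fun_upd_same)
  moreover have "f \<in> insert a A \<rightarrow>\<^sub>E B"
    unfolding PiE_insert_eq fg using b gE by (intro image_eqI[of _ _ "(b, g)"]) auto
  ultimately show "f \<in> surjections (insert a A) B" by (simp add: surjections_def)
qed

text \<open>The decomposition above is the recurrence of the Stirling numbers, multiplied by
  \<^term>\<open>fact (card B)\<close>.\<close>

lemma card_surjections:
  fixes A :: "'a set" and B :: "'b set"
  assumes "finite A" "finite B"
  shows "card (surjections A B) = fact (card B) * Stirling (card A) (card B)"
  using assms
proof (induction A arbitrary: B rule: finite_induct)
  case empty
  show ?case
  proof (cases "B = {}")
    case False
    then have "surjections ({} :: 'a set) B = {}" by (auto simp: surjections_def)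
    moreover obtain l where "card B = Suc l"
      using False empty by (metis card_eq_0_iff not0_implies_Suc)
    ultimately show ?thesis by simp
  qed (auto simp: surjections_def)
next
  case (insert a A)
  show ?case
  proof (cases "B = {}")
    case True
    then show ?thesis using insert.hyps by (auto simp: surjections_def)
  next
    case False
    then obtain l where l: "card B = Suc l"
      using insert.prems by (metis card_eq_0_iff not0_implies_Suc)
    let ?D = "SIGMA b:B. surjections A B \<union> surjections A (B - {b})"
    have "inj_on (\<lambda>(b, g). g(a := b)) (B \<times> (A \<rightarrow>\<^sub>E B))"
      using inj_combinator[OF insert.hyps(2), of "\<lambda>_. B"] by simp
    moreover have "?D \<subseteq> B \<times> (A \<rightarrow>\<^sub>E B)"
      by (auto simp: surjections_def PiE_iff extensional_def)
    ultimately have "inj_on (\<lambda>(b, g). g(a := b)) ?D" by (rule inj_on_subset)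
    then have "card (surjections (insert a A) B) = card ?D"
      unfolding surjections_insert[OF insert.hyps(2)] by (rule card_image)
    also have "\<dots> = (\<Sum>b\<in>B. card (surjections A B \<union> surjections A (B - {b})))"
      using insert.hyps insert.prems by (intro card_SigmaI) (auto intro: finite_surjections)
    also have "\<dots> = (\<Sum>b\<in>B. fact (Suc l) * Stirling (card A) (Suc l) + fact l * Stirling (card A) l)"
    proof (rule sum.cong[OF refl])
      fix b assume b: "b \<in> B"
      have "surjections A B \<inter> surjections A (B - {b}) = {}"
        using b by (auto simp: surjections_def)
      then have "card (surjections A B \<union> surjections A (B - {b}))
          = card (surjections A B) + card (surjections A (B - {b}))"
        using insert.hyps insert.prems by (intro card_Un_disjoint) (auto intro: finite_surjections)
      then show "card (surjections A B \<union> surjections A (B - {b}))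
          = fact (Suc l) * Stirling (card A) (Suc l) + fact l * Stirling (card A) l"
        using insert.IH[of B] insert.IH[of "B - {b}"] insert.prems b l by simp
    qed
    finally show ?thesis using l insert.hyps by (simp add: algebra_simps)
  qed
qed

section \<open>Maps described block by block\<close>

text \<open>Maps on \<open>X\<close> are the same as families of maps on the blocks of a partition, so
  conditions imposed on each block separately multiply.\<close>

lemma card_piecewise_maps:
  assumes "partition_on X P" and "finite P" and "\<And>A. A \<in> P \<Longrightarrow> F A \<subseteq> A \<rightarrow>\<^sub>E Y"
  shows "card {f \<in> X \<rightarrow>\<^sub>E Y. \<forall>A\<in>P. restrict f A \<in> F A} = (\<Prod>A\<in>P. card (F A))"
proof -
  define block where "block x = (THE A. A \<in> P \<and> x \<in> A)" for x
  have block: "block x = A" if "A \<in> P" "x \<in> A" for x A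
    unfolding block_def using that disjointD[OF partition_onD2[OF assms(1)]]
    by (intro the_equality) blast+
  have sub: "A \<subseteq> X" if "A \<in> P" for A using that partition_onD1[OF assms(1)] by blast
  have ex: "\<exists>A\<in>P. x \<in> A" if "x \<in> X" for x using that partition_onD1[OF assms(1)] by blast
  let ?G = "{f \<in> X \<rightarrow>\<^sub>E Y. \<forall>A\<in>P. restrict f A \<in> F A}"
  let ?glue = "\<lambda>h. \<lambda>x\<in>X. h (block x) x"
  have glue: "restrict (?glue h) A = h A" if h: "h \<in> PiE P F" and A: "A \<in> P" for h A
  proof
    fix x
    have "h A \<in> A \<rightarrow>\<^sub>E Y" using assms(3)[OF A] h A by blast
    then show "restrict (?glue h) A x = h A x"
      using block[OF A, of x] sub[OF A] by (auto simp: PiE_def extensional_def)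
  qed
  have "bij_betw (\<lambda>f. \<lambda>A\<in>P. restrict f A) ?G (PiE P F)"
  proof (rule bij_betw_byWitness[where f' = ?glue])
    show "\<forall>f\<in>?G. ?glue (\<lambda>A\<in>P. restrict f A) = f"
    proof
      fix f assume f: "f \<in> ?G"
      show "?glue (\<lambda>A\<in>P. restrict f A) = f"
      proof
        fix x
        show "?glue (\<lambda>A\<in>P. restrict f A) x = f x"
          using f ex[of x] block[of _ x] by (cases "x \<in> X") (auto simp: PiE_def extensional_def)
      qed
    qed
    show "\<forall>h\<in>PiE P F. (\<lambda>A\<in>P. restrict (?glue h) A) = h"
    proof
      fix h assume h: "h \<in> PiE P F"
      show "(\<lambda>A\<in>P. restrict (?glue h) A) = h"
      proof
        fix A
        show "(\<lambda>A\<in>P. restrict (?glue h) A) A = h A"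
          using glue[OF h, of A] PiE_arb[OF h, of A] by (cases "A \<in> P") simp_all
      qed
    qed
    show "(\<lambda>f. \<lambda>A\<in>P. restrict f A) ` ?G \<subseteq> PiE P F" by auto
    show "?glue ` PiE P F \<subseteq> ?G"
    proof
      fix f assume "f \<in> ?glue ` PiE P F"
      then obtain h where h: "h \<in> PiE P F" and f: "f = ?glue h" by blast
      have "restrict f A \<in> F A" if "A \<in> P" for A
        unfolding f glue[OF h that] using h that by blast
      moreover have "h (block x) x \<in> Y" if x: "x \<in> X" for x
      proof -
        obtain A where A: "A \<in> P" "x \<in> A" using ex[OF x] by blast
        have "h A \<in> A \<rightarrow>\<^sub>E Y" using assms(3)[OF A(1)] h A(1) by blast
        then show ?thesis using A block[OF A] by auto
      qed
      then have "f \<in> X \<rightarrow>\<^sub>E Y" unfolding f by auto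
      ultimately show "f \<in> ?G" by blast
    qed
  qed
  then have "card ?G = card (PiE P F)" by (rule bij_betw_same_card)
  then show ?thesis using card_PiE[OF assms(2)] by simp
qed

section \<open>Idempotents with prescribed image blocks\<close>

definition idempotents_onto_blocks :: "'a set \<Rightarrow> 'a set set \<Rightarrow> 'a set set \<Rightarrow> ('a \<Rightarrow> 'a) set" where
  "idempotents_onto_blocks X P R = {f \<in> idempotents X (Gamma X P). (`) f ` P = R}"

definition idempotent_pieces :: "'a set set \<Rightarrow> 'a set \<Rightarrow> ('a \<Rightarrow> 'a) set" where
  "idempotent_pieces R A = (if A \<in> R then {\<lambda>x\<in>A. x} else (\<Union>B\<in>R. surjections A B))"

text \<open>An idempotent fixes every point of its image, hence every point of an image block;
  this gives one inclusion.  For the other, a map with these pieces sends every point into some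
  member of \<open>R\<close>, where it is the identity, so it is idempotent.\<close>

lemma idempotents_onto_blocks_eq_piecewise:
  assumes P: "partition_on X P" and R: "R \<subseteq> P"
  shows "idempotents_onto_blocks X P R =
    {f \<in> X \<rightarrow>\<^sub>E X. \<forall>A\<in>P. restrict f A \<in> idempotent_pieces R A}"
proof (intro subset_antisym subsetI)
  have sub: "A \<subseteq> X" if "A \<in> P" for A using that partition_onD1[OF P] by blast
  fix f assume "f \<in> idempotents_onto_blocks X P R"
  then have f: "f \<in> X \<rightarrow>\<^sub>E X" and idem: "compose X f f = f" and im: "(`) f ` P = R"
    by (auto simp: idempotents_onto_blocks_def idempotents_def Gamma_def)
  have "restrict f A \<in> idempotent_pieces R A" if A: "A \<in> P" for A
  proof (cases "A \<in> R")
    case True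
    then obtain C where C: "C \<in> P" "A = f ` C" using im by blast
    have "f (f x) = f x" if "x \<in> X" for x using fun_cong[OF idem, of x] that by (simp add: compose_def)
    then have "f y = y" if "y \<in> A" for y using that C sub[OF C(1)] by auto
    then show ?thesis using True by (auto simp: idempotent_pieces_def)
  next
    case False
    have "restrict f A \<in> surjections A (f ` A)" by (auto simp: surjections_def)
    then show ?thesis using False A im by (auto simp: idempotent_pieces_def)
  qed
  then show "f \<in> {f \<in> X \<rightarrow>\<^sub>E X. \<forall>A\<in>P. restrict f A \<in> idempotent_pieces R A}" using f by blast
next
  fix f assume "f \<in> {f \<in> X \<rightarrow>\<^sub>E X. \<forall>A\<in>P. restrict f A \<in> idempotent_pieces R A}"
  then have f: "f \<in> X \<rightarrow>\<^sub>E X" and pieces: "\<And>A. A \<in> P \<Longrightarrow> restrict f A \<in> idempotent_pieces R A" by auto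
  have fixed: "f x = x" if "B \<in> R" "x \<in> B" for B x
  proof -
    have "restrict f B = (\<lambda>x\<in>B. x)" using pieces[of B] that R by (auto simp: idempotent_pieces_def)
    then show ?thesis using that(2) by (metis restrict_apply)
  qed
  have fixed_im: "f ` B = B" if "B \<in> R" for B using fixed[OF that] by simp
  have im: "f ` A \<in> R" if A: "A \<in> P" for A
  proof (cases "A \<in> R")
    case False
    then obtain B where "B \<in> R" "restrict f A ` A = B"
      using pieces[OF A] by (auto simp: idempotent_pieces_def surjections_def)
    then show ?thesis by simp
  qed (simp add: fixed_im)
  have "(`) f ` P = R"
  proof
    show "R \<subseteq> (`) f ` P"
    proof
      fix B assume "B \<in> R"
      then show "B \<in> (`) f ` P" using fixed_im[of B] R by (intro image_eqI[of _ _ B]) auto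
    qed
  qed (use im in blast)
  moreover have "compose X f f = f"
  proof
    fix x
    show "compose X f f x = f x"
    proof (cases "x \<in> X")
      case True
      then obtain A where "A \<in> P" "x \<in> A" using partition_onD1[OF P] by blast
      then have "f (f x) = f x" using fixed[of "f ` A" "f x"] im by blast
      then show ?thesis using True by (simp add: compose_def)
    next
      case False
      then show ?thesis using f by (auto simp: compose_def PiE_def extensional_def)
    qed
  qed
  ultimately show "f \<in> idempotents_onto_blocks X P R"
    using f im R by (auto simp: idempotents_onto_blocks_def idempotents_def Gamma_def)
qed

lemma card_idempotents_onto_blocks:
  assumes X: "finite X" and P: "partition_on X P" and R: "R \<subseteq> P"
  shows "card (idempotents_onto_blocks X P R) =
    (\<Prod>A\<in>P - R. \<Sum>B\<in>R. fact (card B) * Stirling (card A) (card B))"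
proof -
  have finP: "finite P" using finite_elements[OF X P] .
  have sub: "A \<subseteq> X" if "A \<in> P" for A using that partition_onD1[OF P] by blast
  have fin: "finite A" if "A \<in> P" for A using finite_subset[OF sub[OF that] X] .
  have "idempotent_pieces R A \<subseteq> A \<rightarrow>\<^sub>E X" if A: "A \<in> P" for A
  proof (cases "A \<in> R")
    case True
    then show ?thesis using sub[OF A] by (auto simp: idempotent_pieces_def)
  next
    case False
    have "surjections A B \<subseteq> A \<rightarrow>\<^sub>E X" if "B \<in> R" for B
      using sub[of B] that R by (auto simp: surjections_def PiE_iff extensional_def)
    then show ?thesis using False by (auto simp: idempotent_pieces_def)
  qed
  then have "card (idempotents_onto_blocks X P R) = (\<Prod>A\<in>P. card (idempotent_pieces R A))"
    unfolding idempotents_onto_blocks_eq_piecewise[OF P R]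
    by (rule card_piecewise_maps[OF P finP])
  also have "\<dots> = (\<Prod>A\<in>P - R. card (idempotent_pieces R A))"
    using finP by (intro prod.mono_neutral_right) (auto simp: idempotent_pieces_def)
  also have "\<dots> = (\<Prod>A\<in>P - R. \<Sum>B\<in>R. fact (card B) * Stirling (card A) (card B))"
  proof (rule prod.cong[OF refl])
    fix A assume A: "A \<in> P - R"
    have "card (\<Union>B\<in>R. surjections A B) = (\<Sum>B\<in>R. card (surjections A B))"
    proof (rule card_UN_disjoint)
      show "finite R" using finite_subset[OF R finP] .
      show "\<forall>B\<in>R. finite (surjections A B)" using A R fin by (blast intro: finite_surjections)
      show "\<forall>B\<in>R. \<forall>C\<in>R. B \<noteq> C \<longrightarrow> surjections A B \<inter> surjections A C = {}"
        by (auto simp: surjections_def)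
    qed
    also have "\<dots> = (\<Sum>B\<in>R. fact (card B) * Stirling (card A) (card B))"
      using A R fin by (intro sum.cong refl card_surjections) auto
    finally show "card (idempotent_pieces R A)
        = (\<Sum>B\<in>R. fact (card B) * Stirling (card A) (card B))"
      using A by (simp add: idempotent_pieces_def)
  qed
  finally show ?thesis .
qed

text \<open>A smallest block has no surjection onto a larger one, so its image is again a smallest
  block.\<close>

lemma idempotents_onto_blocks_smallest:
  assumes X: "finite X" and P: "partition_on X P"
    and A: "A \<in> P" and min: "\<And>B. B \<in> P \<Longrightarrow> card A \<le> card B"
    and f: "f \<in> idempotents_onto_blocks X P R"
  shows "blocks_of_size R (card A) \<noteq> {}"
proof -
  have "f ` A \<in> R" "f ` A \<in> P"
    using f A by (auto simp: idempotents_onto_blocks_def idempotents_def Gamma_def)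
  moreover have "A \<subseteq> X" using A partition_onD1[OF P] by blast
  then have "finite A" using X finite_subset by metis
  then have "card (f ` A) \<le> card A" by (rule card_image_le)
  ultimately have "f ` A \<in> blocks_of_size R (card A)"
    using min[of "f ` A"] by (simp add: blocks_of_size_def)
  then show ?thesis by blast
qed

section \<open>Collecting blocks by size\<close>

lemma sum_over_block_sizes:
  fixes g :: "nat \<Rightarrow> 'b::comm_semiring_1"
  assumes "finite R" and "inj_on n I" and "finite I" and "card ` R \<subseteq> n ` I"
  shows "(\<Sum>B\<in>R. g (card B)) = (\<Sum>i\<in>I. of_nat (card (blocks_of_size R (n i))) * g (n i))"
proof -
  have "(\<Sum>B\<in>R. g (card B)) = (\<Sum>s\<in>n ` I. \<Sum>B\<in>{B \<in> R. card B = s}. g (card B))"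
    using assms by (intro sum.group[symmetric]) auto
  also have "\<dots> = (\<Sum>i\<in>I. \<Sum>B\<in>{B \<in> R. card B = n i}. g (card B))"
    using assms by (simp add: sum.reindex)
  also have "\<dots> = (\<Sum>i\<in>I. of_nat (card (blocks_of_size R (n i))) * g (n i))"
    by (intro sum.cong refl) (simp add: blocks_of_size_def)
  finally show ?thesis .
qed

lemma prod_over_block_sizes:
  fixes g :: "nat \<Rightarrow> 'b::comm_semiring_1"
  assumes "finite R" and "inj_on n I" and "finite I" and "card ` R \<subseteq> n ` I"
  shows "(\<Prod>B\<in>R. g (card B)) = (\<Prod>i\<in>I. g (n i) ^ card (blocks_of_size R (n i)))"
proof -
  have "(\<Prod>B\<in>R. g (card B)) = (\<Prod>s\<in>n ` I. \<Prod>B\<in>{B \<in> R. card B = s}. g (card B))"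
    using assms by (intro prod.group[symmetric]) auto
  also have "\<dots> = (\<Prod>i\<in>I. \<Prod>B\<in>{B \<in> R. card B = n i}. g (card B))"
    using assms by (simp add: prod.reindex)
  also have "\<dots> = (\<Prod>i\<in>I. g (n i) ^ card (blocks_of_size R (n i)))"
    by (intro prod.cong refl) (simp add: blocks_of_size_def)
  finally show ?thesis .
qed

text \<open>If the multiplicities of \<open>k\<close> numbers already account for all blocks, then every block size
  is among these numbers; since there are \<open>k\<close> sizes, all of these numbers occur.\<close>

lemma block_sizes_eq:
  assumes "finite P" and "inj_on n I" and "finite I" and "card (card ` P) = card I"
    and "card P = (\<Sum>i\<in>I. card (blocks_of_size P (n i)))"
  shows "card ` P = n ` I"
proof -
  let ?U = "\<Union>i\<in>I. blocks_of_size P (n i)"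
  have "card ?U = (\<Sum>i\<in>I. card (blocks_of_size P (n i)))"
    using assms(1-3) by (intro card_UN_disjoint) (auto simp: blocks_of_size_def inj_on_def)
  moreover have "?U \<subseteq> P" by (auto simp: blocks_of_size_def)
  ultimately have "?U = P" using assms(1,5) by (simp add: card_subset_eq)
  then have "card ` P \<subseteq> n ` I" by (auto simp: blocks_of_size_def)
  then show ?thesis
    using assms(2-4) by (intro card_subset_eq) (simp_all add: card_image)
qed

section \<open>The number of idempotents\<close>

text \<open>The count of idempotents with image blocks \<open>R\<close>, rewritten in terms of sizes.  The terms with
  \<open>j > i\<close> are dropped because then \<^term>\<open>Stirling (n i) (n j)\<close> is zero.\<close>

lemma card_idempotents_onto_blocks_by_size:
  fixes n :: "nat \<Rightarrow> nat"
  assumes X: "finite X" and P: "partition_on X P" and R: "R \<subseteq> P"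
    and mono: "strict_mono_on {1..k} n" and sizes: "card ` P \<subseteq> n ` {1..k}"
  shows "card (idempotents_onto_blocks X P R) =
    (\<Prod>i=1..k. (\<Sum>j=1..i. card (blocks_of_size R (n j)) * fact (n j) * Stirling (n i) (n j))
       ^ (card (blocks_of_size P (n i)) - card (blocks_of_size R (n i))))"
proof -
  have finP: "finite P" using finite_elements[OF X P] .
  have finR: "finite R" using finite_subset[OF R finP] .
  have inj: "inj_on n {1..k}" using mono by (rule strict_mono_on_imp_inj_on)
  have sizesR: "card ` R \<subseteq> n ` {1..k}" and sizesPR: "card ` (P - R) \<subseteq> n ` {1..k}"
    using sizes R by auto
  have "card (idempotents_onto_blocks X P R)
      = (\<Prod>A\<in>P - R. \<Sum>B\<in>R. fact (card B) * Stirling (card A) (card B))"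
    by (rule card_idempotents_onto_blocks[OF X P R])
  also have "\<dots> = (\<Prod>i=1..k. (\<Sum>B\<in>R. fact (card B) * Stirling (n i) (card B))
      ^ card (blocks_of_size (P - R) (n i)))"
    using prod_over_block_sizes[OF _ inj _ sizesPR,
        of "\<lambda>s. \<Sum>B\<in>R. fact (card B) * Stirling s (card B)"] finP by simp
  also have "\<dots> = (\<Prod>i=1..k.
      (\<Sum>j=1..i. card (blocks_of_size R (n j)) * fact (n j) * Stirling (n i) (n j))
       ^ (card (blocks_of_size P (n i)) - card (blocks_of_size R (n i))))"
  proof (rule prod.cong[OF refl])
    fix i assume i: "i \<in> {1..k}"
    have "blocks_of_size (P - R) (n i) = blocks_of_size P (n i) - blocks_of_size R (n i)"
      by (auto simp: blocks_of_size_def)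
    moreover have "blocks_of_size R (n i) \<subseteq> blocks_of_size P (n i)"
      using R by (auto simp: blocks_of_size_def)
    ultimately have "card (blocks_of_size (P - R) (n i))
        = card (blocks_of_size P (n i)) - card (blocks_of_size R (n i))"
      using finR by (simp add: card_Diff_subset blocks_of_size_def)
    moreover have "(\<Sum>B\<in>R. fact (card B) * Stirling (n i) (card B))
        = (\<Sum>j=1..i. card (blocks_of_size R (n j)) * fact (n j) * Stirling (n i) (n j))"
    proof -
      have "(\<Sum>B\<in>R. fact (card B) * Stirling (n i) (card B))
          = (\<Sum>j=1..k. card (blocks_of_size R (n j)) * fact (n j) * Stirling (n i) (n j))"
        using sum_over_block_sizes[OF finR inj _ sizesR, of "\<lambda>s. fact s * Stirling (n i) s"]
        by (simp add: mult.assoc)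
      also have "\<dots> = (\<Sum>j=1..i. card (blocks_of_size R (n j)) * fact (n j) * Stirling (n i) (n j))"
      proof (rule sum.mono_neutral_right)
        show "\<forall>j\<in>{1..k} - {1..i}.
            card (blocks_of_size R (n j)) * fact (n j) * Stirling (n i) (n j) = 0"
        proof
          fix j assume "j \<in> {1..k} - {1..i}"
          then have "n i < n j" using i strict_mono_onD[OF mono, of i j] by auto
          then show "card (blocks_of_size R (n j)) * fact (n j) * Stirling (n i) (n j) = 0" by simp
        qed
      qed (use i in auto)
      finally show ?thesis .
    qed
    ultimately show "(\<Sum>B\<in>R. fact (card B) * Stirling (n i) (card B))
          ^ card (blocks_of_size (P - R) (n i))
        = (\<Sum>j=1..i. card (blocks_of_size R (n j)) * fact (n j) * Stirling (n i) (n j))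
          ^ (card (blocks_of_size P (n i)) - card (blocks_of_size R (n i)))" by simp
  qed
  finally show ?thesis .
qed

theorem theorem6p6:
  fixes X :: "'a set" and P :: "'a set set"
    and m k :: nat and n mult \<mu> :: "nat \<Rightarrow> nat"
    and \<FF> :: "nat \<Rightarrow> 'a set set set" and Q :: "nat \<Rightarrow> nat \<Rightarrow> 'a set set"
  assumes "finite X" and "card X \<ge> 3"
    and "mk_partition_on m k X P"
    and "strict_mono_on {1..k} n"
    and "\<And>i. i \<in> {1..k} \<Longrightarrow> card (blocks_of_size P (n i)) = mult i"
    and "m = (\<Sum>i=1..k. mult i)"
    and "\<And>r. r \<in> {1..m} \<Longrightarrow>
           \<FF> r = {R \<in> subpartitions r P. blocks_of_size R (n 1) \<noteq> {}}"
    and "\<And>r. r \<in> {1..m} \<Longrightarrow> \<mu> r = card (\<FF> r)"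
    and "\<And>r. r \<in> {1..m} \<Longrightarrow> bij_betw (Q r) {1..\<mu> r} (\<FF> r)"
  shows "card (idempotents X (Gamma X P)) =
    (\<Sum>r=1..m. \<Sum>t=1..\<mu> r. \<Prod>i=1..k.
      (\<Sum>j=1..i. card (blocks_of_size (Q r t) (n j)) * fact (n j) * Stirling (n i) (n j))
        ^ (mult i - card (blocks_of_size (Q r t) (n i))))"
proof -
  note X = assms(1) and mono = assms(4) and mult = assms(5)
  have P: "partition_on X P" and k: "0 < k" and cardP: "card P = m" and cards: "card (card ` P) = k"
    using assms(3) by (auto simp: mk_partition_on_def)
  have finP: "finite P" using finite_elements[OF X P] .
  have inj: "inj_on n {1..k}" using mono by (rule strict_mono_on_imp_inj_on)
  have sizes: "card ` P = n ` {1..k}"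
    using finP inj cards cardP assms(6) mult by (intro block_sizes_eq) auto
  define smallest :: "'a set set set" where "smallest = {R. R \<subseteq> P \<and> blocks_of_size R (n 1) \<noteq> {}}"
  have fin_smallest: "finite smallest"
    unfolding smallest_def using finP by (auto intro: finite_subset[of _ "Pow P"])
  define N :: "'a set set \<Rightarrow> nat" where "N R = (\<Prod>i=1..k.
      (\<Sum>j=1..i. card (blocks_of_size R (n j)) * fact (n j) * Stirling (n i) (n j))
        ^ (mult i - card (blocks_of_size R (n i))))" for R
  have "n 1 \<in> card ` P" unfolding sizes using k by auto
  then obtain A where A: "A \<in> P" "card A = n 1" by auto
  have min: "card A \<le> card B" if "B \<in> P" for B
  proof -
    have "card B \<in> n ` {1..k}" using that sizes by blast
    then obtain i where i: "i \<in> {1..k}" "card B = n i" by blast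
    then have "n 1 \<le> n i" using strict_mono_onD[OF mono, of 1 i] by (cases "i = 1") auto
    then show ?thesis using A(2) i(2) by simp
  qed
  let ?E = "idempotents X (Gamma X P)"
  have finE: "finite ?E"
    by (rule finite_subset[of _ "X \<rightarrow>\<^sub>E X"]) (auto simp: idempotents_def Gamma_def X finite_PiE)
  have "(`) f ` P \<in> smallest" if f: "f \<in> ?E" for f
  proof -
    have "blocks_of_size ((`) f ` P) (n 1) \<noteq> {}"
      using idempotents_onto_blocks_smallest[OF X P A(1) min, of f "(`) f ` P"] f A(2)
      by (simp add: idempotents_onto_blocks_def)
    then show ?thesis using f by (auto simp: smallest_def idempotents_def Gamma_def)
  qed
  then have "(\<lambda>f. (`) f ` P) ` ?E \<subseteq> smallest" by blast
  then have "(\<Sum>f\<in>?E. 1) = (\<Sum>R\<in>smallest. \<Sum>f\<in>{f \<in> ?E. (`) f ` P = R}. 1 :: nat)"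
    by (rule sum.group[OF finE fin_smallest, symmetric])
  then have "card ?E = (\<Sum>R\<in>smallest. card (idempotents_onto_blocks X P R))"
    by (simp add: idempotents_onto_blocks_def)
  also have "\<dots> = (\<Sum>R\<in>smallest. N R)"
  proof (rule sum.cong[OF refl])
    fix R assume "R \<in> smallest"
    then have "R \<subseteq> P" by (simp add: smallest_def)
    then show "card (idempotents_onto_blocks X P R) = N R"
      using card_idempotents_onto_blocks_by_size[OF X P _ mono, of R] sizes mult
      by (simp add: N_def)
  qed
  also have "\<dots> = (\<Sum>r=1..m. \<Sum>R\<in>{R \<in> smallest. card R = r}. N R)"
  proof (rule sum.group[OF fin_smallest, symmetric])
    have "card R \<in> {1..m}" if R: "R \<in> smallest" for R
    proof -
      have "finite R" "R \<noteq> {}" "R \<subseteq> P"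
        using R finP finite_subset by (auto simp: smallest_def blocks_of_size_def)
      then show ?thesis using card_mono[OF finP, of R] cardP by (simp add: Suc_le_eq card_gt_0_iff)
    qed
    then show "card ` smallest \<subseteq> {1..m}" by blast
  qed simp
  also have "\<dots> = (\<Sum>r=1..m. \<Sum>t=1..\<mu> r. N (Q r t))"
  proof (rule sum.cong[OF refl])
    fix r assume r: "r \<in> {1..m}"
    have "{R \<in> smallest. card R = r} = \<FF> r"
      unfolding assms(7)[OF r] by (auto simp: smallest_def subpartitions_def)
    then show "(\<Sum>R\<in>{R \<in> smallest. card R = r}. N R) = (\<Sum>t=1..\<mu> r. N (Q r t))"
      using sum.reindex_bij_betw[OF assms(9)[OF r], of N] by simp
  qed
  finally show ?thesis unfolding N_def .
qed

end
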